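(* There exist a group $G$ and a tame minimal compact metric $G$-system $X$ such that the affine $G$-system $P(X)$ of probability measures on $X$ does not have a fixed point (equivalently, $X$ does not have a $G$-invariant probability measure).
   Context: A compact $G$-system is a compact Hausdorff space $X$ with an action of the group $G$ by homeomorphisms; it is minimal if it is nonempty and has no proper nonempty closed $G$-invariant subset; it is metric if $X$ is metrizable. $P(X)$ is the compact convex space of regular Borel probability measures on $X$ (weak$^*$ topology) with the induced $G$-action. The enveloping semigroup $E(X)$ is the closure of the set of translations $\{x\mapsto gx: g\in G\}$ in $X^X$ with the topology of pointwise convergence. $X$ is tame if every $p\in E(X)$ is fragmented as a map $p:X\to X$, i.e. for every nonempty $A\subset X$ and every entourage $\varepsilon$ of the compatible uniformity of $X$ there is an open $O\subset X$ with $O\cap A\ne\emptyset$ and $p(O\cap A)\times p(O\cap A)\subset\varepsilon$; for metrizable $X$ this is equivalent to every $p\in E(X)$ being a Baire class 1 function. *)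

theory Defs
  imports "HOL-Probability.Probability" "HOL-Algebra.Group_Action"
begin

section \<open>Uniformities\<close>

text \<open>
  A uniform structure on a set \<open>S\<close>, given by its entourages. The library only has the type class
  of uniform spaces, whereas here the underlying space is the carrier of a topology.
\<close>

definition uniform_structure_on :: "'a set \<Rightarrow> ('a \<times> 'a) set set \<Rightarrow> bool" where
  "uniform_structure_on S \<U> \<longleftrightarrow>
     \<U> \<noteq> {} \<and>
     (\<forall>E\<in>\<U>. Id_on S \<subseteq> E \<and> E \<subseteq> S \<times> S) \<and>
     (\<forall>E\<in>\<U>. \<forall>F. E \<subseteq> F \<and> F \<subseteq> S \<times> S \<longrightarrow> F \<in> \<U>) \<and>
     (\<forall>E\<in>\<U>. \<forall>F\<in>\<U>. E \<inter> F \<in> \<U>) \<and>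
     (\<forall>E\<in>\<U>. E\<inverse> \<in> \<U>) \<and>
     (\<forall>E\<in>\<U>. \<exists>F\<in>\<U>. F O F \<subseteq> E)"

definition compatible_uniformity :: "'a topology \<Rightarrow> ('a \<times> 'a) set set \<Rightarrow> bool" where
  "compatible_uniformity X \<U> \<longleftrightarrow>
     uniform_structure_on (topspace X) \<U> \<and>
     (\<forall>U. openin X U \<longleftrightarrow> U \<subseteq> topspace X \<and> (\<forall>x\<in>U. \<exists>E\<in>\<U>. E `` {x} \<subseteq> U))"

text \<open>
  A compact Hausdorff space has exactly one compatible uniformity, so on such spaces the
  existential quantifier below just names that uniformity.
\<close>

definition entourage :: "'a topology \<Rightarrow> ('a \<times> 'a) set \<Rightarrow> bool" where
  "entourage X E \<longleftrightarrow> (\<exists>\<U>. compatible_uniformity X \<U> \<and> E \<in> \<U>)"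

lemma (in Metric_space) compatible_uniformity_mtopology:
  "compatible_uniformity mtopology
     {E. E \<subseteq> M \<times> M \<and> (\<exists>e>0. \<forall>x\<in>M. \<forall>y\<in>M. d x y < e \<longrightarrow> (x, y) \<in> E)}"
  (is "compatible_uniformity _ ?U")
proof -
  let ?B = "\<lambda>e::real. {(x, y). x \<in> M \<and> y \<in> M \<and> d x y < e}"
  have B: "?B e \<in> ?U" if "e > 0" for e
    using that by auto
  have "uniform_structure_on M ?U"
    unfolding uniform_structure_on_def
  proof (intro conjI ballI allI impI)
    show "?U \<noteq> {}"
      using B[OF zero_less_one] by blast
  next
    fix E assume "E \<in> ?U"
    then show "Id_on M \<subseteq> E" and "E \<subseteq> M \<times> M"
      by auto
  next
    fix E F assume "E \<in> ?U" "E \<subseteq> F \<and> F \<subseteq> M \<times> M"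
    then show "F \<in> ?U"
      by blast
  next
    fix E F assume E: "E \<in> ?U" and F: "F \<in> ?U"
    then obtain e f where "e > 0" "f > 0"
      and "\<forall>x\<in>M. \<forall>y\<in>M. d x y < e \<longrightarrow> (x, y) \<in> E"
      and "\<forall>x\<in>M. \<forall>y\<in>M. d x y < f \<longrightarrow> (x, y) \<in> F"
      by blast
    then have "min e f > 0 \<and> (\<forall>x\<in>M. \<forall>y\<in>M. d x y < min e f \<longrightarrow> (x, y) \<in> E \<inter> F)"
      by auto
    then have "\<exists>e>0. \<forall>x\<in>M. \<forall>y\<in>M. d x y < e \<longrightarrow> (x, y) \<in> E \<inter> F"
      by blast
    then show "E \<inter> F \<in> ?U"
      using E by blast
  next
    fix E assume "E \<in> ?U"
    then show "E\<inverse> \<in> ?U"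
      by (auto simp: commute)
  next
    fix E assume "E \<in> ?U"
    then obtain e where e: "e > 0" "\<forall>x\<in>M. \<forall>y\<in>M. d x y < e \<longrightarrow> (x, y) \<in> E"
      by blast
    have "(x, z) \<in> E" if "(x, y) \<in> ?B (e/2)" "(y, z) \<in> ?B (e/2)" for x y z
      using that e(2) triangle[of x y z] by force
    then have "?B (e/2) O ?B (e/2) \<subseteq> E"
      by blast
    then show "\<exists>F\<in>?U. F O F \<subseteq> E"
      using B[OF half_gt_zero[OF e(1)]] by (rule bexI)
  qed
  moreover have "(\<exists>r>0. mball x r \<subseteq> U) \<longleftrightarrow> (\<exists>E\<in>?U. E `` {x} \<subseteq> U)" if "x \<in> M" for x U
  proof
    assume "\<exists>r>0. mball x r \<subseteq> U"
    then obtain r where "r > 0" "mball x r \<subseteq> U"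
      by blast
    then have "?B r `` {x} \<subseteq> U"
      by (auto simp: mball_def)
    then show "\<exists>E\<in>?U. E `` {x} \<subseteq> U"
      using B[OF \<open>r > 0\<close>] by blast
  next
    assume "\<exists>E\<in>?U. E `` {x} \<subseteq> U"
    then obtain E e where "E `` {x} \<subseteq> U" "e > 0" "\<forall>x\<in>M. \<forall>y\<in>M. d x y < e \<longrightarrow> (x, y) \<in> E"
      by blast
    then have "mball x e \<subseteq> U"
      using \<open>x \<in> M\<close> by (auto simp: mball_def)
    then show "\<exists>r>0. mball x r \<subseteq> U"
      using \<open>e > 0\<close> by blast
  qed
  then have "openin mtopology U \<longleftrightarrow> U \<subseteq> M \<and> (\<forall>x\<in>U. \<exists>E\<in>?U. E `` {x} \<subseteq> U)" for U
    unfolding openin_mtopology by (intro conj_cong refl) (simp add: subset_iff Ball_def)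
  ultimately show ?thesis
    unfolding compatible_uniformity_def topspace_mtopology by (intro conjI allI)
qed

section \<open>Compact systems\<close>

text \<open>
  \<open>group_action\<close> is the library's notion, a homomorphism into the group of bijections of the
  space; it makes every translation \<open>\<phi> g\<close> extensional on \<open>topspace X\<close>.
\<close>

definition compact_G_system ::
    "('g, 'b) monoid_scheme \<Rightarrow> 'a topology \<Rightarrow> ('g \<Rightarrow> 'a \<Rightarrow> 'a) \<Rightarrow> bool" where
  "compact_G_system G X \<phi> \<longleftrightarrow>
     compact_space X \<and> Hausdorff_space X \<and>
     group_action G (topspace X) \<phi> \<and>
     (\<forall>g\<in>carrier G. homeomorphic_map X X (\<phi> g))"

definition minimal_system ::
    "('g, 'b) monoid_scheme \<Rightarrow> 'a topology \<Rightarrow> ('g \<Rightarrow> 'a \<Rightarrow> 'a) \<Rightarrow> bool" where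
  "minimal_system G X \<phi> \<longleftrightarrow>
     topspace X \<noteq> {} \<and>
     \<not> (\<exists>C. closedin X C \<and> C \<noteq> {} \<and> C \<noteq> topspace X \<and> (\<forall>g\<in>carrier G. \<phi> g ` C \<subseteq> C))"

definition enveloping_semigroup ::
    "('g, 'b) monoid_scheme \<Rightarrow> 'a topology \<Rightarrow> ('g \<Rightarrow> 'a \<Rightarrow> 'a) \<Rightarrow> ('a \<Rightarrow> 'a) set" where
  "enveloping_semigroup G X \<phi> =
     product_topology (\<lambda>_. X) (topspace X) closure_of (\<phi> ` carrier G)"

definition fragmented_map :: "'a topology \<Rightarrow> ('a \<Rightarrow> 'a) \<Rightarrow> bool" where
  "fragmented_map X p \<longleftrightarrow>
     (\<forall>A E. A \<subseteq> topspace X \<and> A \<noteq> {} \<and> entourage X E \<longrightarrow>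
        (\<exists>U. openin X U \<and> U \<inter> A \<noteq> {} \<and> p ` (U \<inter> A) \<times> p ` (U \<inter> A) \<subseteq> E))"

definition tame_system ::
    "('g, 'b) monoid_scheme \<Rightarrow> 'a topology \<Rightarrow> ('g \<Rightarrow> 'a \<Rightarrow> 'a) \<Rightarrow> bool" where
  "tame_system G X \<phi> \<longleftrightarrow> (\<forall>p\<in>enveloping_semigroup G X \<phi>. fragmented_map X p)"

definition has_fixed_point ::
    "('g, 'b) monoid_scheme \<Rightarrow> 'a topology \<Rightarrow> ('g \<Rightarrow> 'a \<Rightarrow> 'a) \<Rightarrow> bool" where
  "has_fixed_point G X \<phi> \<longleftrightarrow> (\<exists>x\<in>topspace X. \<forall>g\<in>carrier G. \<phi> g x = x)"

section \<open>The system of probability measures\<close>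

definition borel_algebra :: "'a topology \<Rightarrow> 'a measure" where
  "borel_algebra X = sigma (topspace X) {U. openin X U}"

definition regular_borel_probability :: "'a topology \<Rightarrow> 'a measure \<Rightarrow> bool" where
  "regular_borel_probability X \<mu> \<longleftrightarrow>
     sets \<mu> = sets (borel_algebra X) \<and> prob_space \<mu> \<and>
     (\<forall>A\<in>sets \<mu>.
        emeasure \<mu> A = (SUP K\<in>{K. compactin X K \<and> K \<subseteq> A}. emeasure \<mu> K) \<and>
        emeasure \<mu> A = (INF U\<in>{U. openin X U \<and> A \<subseteq> U}. emeasure \<mu> U))"

text \<open>
  \<open>P(X)\<close> with the weak* topology: the coarsest one for which integration against each continuous
  real function on \<open>X\<close> is continuous.
\<close>

definition prob_measures_topology :: "'a topology \<Rightarrow> 'a measure topology" where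
  "prob_measures_topology X =
     (let C = {f. continuous_map X euclideanreal f} in
      pullback_topology {\<mu>. regular_borel_probability X \<mu>}
        (\<lambda>\<mu>. \<lambda>f\<in>C. \<integral>x. f x \<partial>\<mu>)
        (product_topology (\<lambda>_. euclideanreal) C))"

lemma topspace_prob_measures_topology [simp]:
  "topspace (prob_measures_topology X) = {\<mu>. regular_borel_probability X \<mu>}"
  by (auto simp: prob_measures_topology_def Let_def topspace_pullback_topology)

definition prob_measures_action ::
    "'a topology \<Rightarrow> ('g \<Rightarrow> 'a \<Rightarrow> 'a) \<Rightarrow> 'g \<Rightarrow> 'a measure \<Rightarrow> 'a measure" where
  "prob_measures_action X \<phi> g =
     (\<lambda>\<mu>\<in>topspace (prob_measures_topology X). distr \<mu> (borel_algebra X) (\<phi> g))"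

definition invariant_measure ::
    "('g, 'b) monoid_scheme \<Rightarrow> ('g \<Rightarrow> 'a \<Rightarrow> 'a) \<Rightarrow> 'a measure \<Rightarrow> bool" where
  "invariant_measure G \<phi> \<mu> \<longleftrightarrow>
     (\<forall>g\<in>carrier G. \<forall>A\<in>sets \<mu>. emeasure \<mu> (\<phi> g ` A) = emeasure \<mu> A)"

end

theory Submission
  imports Defs
begin

text \<open>
  The system is the unit circle under the group of all its bijections preserving the cross-ratio,
  that is, the Moebius transformations of the circle.

  Tameness. Cleared of denominators, preservation of the cross-ratio is a polynomial identity
  between the values of a map at four points, so it survives pointwise limits and holds for every
  element of the enveloping semigroup. A map satisfying it is rigid
  (\<open>moebius_identity_dichotomy\<close>): either it is injective, and then three of its values determine it
  as a fractional linear, hence continuous, function; or it is constant off a single point. Maps of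
  either kind are fragmented.

  Minimality holds because the rotations act transitively.

  There is no invariant measure because of the hyperbolic map \<open>z \<mapsto> (2z + 1) / (z + 2)\<close>. It maps
  the arc \<open>Re z > - 4/5\<close> onto the smaller arc \<open>Re z > 0\<close>, so an invariant measure vanishes on
  the difference \<open>- 4/5 < Re z \<le> 0\<close>. Four rotated copies of this difference cover the
  circle, which would then have measure zero (\<open>no_invariant_measure_circle\<close>). A fixed point
  in the space of probability measures is such an invariant measure.
\<close>

section \<open>Fragmented maps\<close>

text \<open>
  Entourages only yield neighbourhoods, not open sets; the interior of \<open>E `` {y}\<close> is found by
  halving entourages.
\<close>

lemma compatible_uniformity_nhd:
  assumes "compatible_uniformity X \<U>" "E \<in> \<U>" "y \<in> topspace X"
  obtains V where "openin X V" "y \<in> V" "V \<subseteq> E `` {y}"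
proof
  note U = assms(1)[unfolded compatible_uniformity_def uniform_structure_on_def]
  let ?V = "{z \<in> topspace X. \<exists>D\<in>\<U>. D `` {z} \<subseteq> E `` {y}}"
  show "y \<in> ?V"
    using assms by auto
  have refl: "(z, z) \<in> D" if "D \<in> \<U>" "z \<in> topspace X" for D z
    using U that by (auto simp: Id_on_def)
  show "?V \<subseteq> E `` {y}"
    using refl by blast
  have "\<exists>D'\<in>\<U>. D' `` {z} \<subseteq> ?V" if z: "z \<in> ?V" for z
  proof -
    obtain D where D: "D \<in> \<U>" "D `` {z} \<subseteq> E `` {y}"
      using z by blast
    then obtain D' where D': "D' \<in> \<U>" "D' O D' \<subseteq> D"
      using U by meson
    have "D' \<subseteq> topspace X \<times> topspace X"
      using U D' by blast
    moreover have "D' `` {w} \<subseteq> E `` {y}" if "(z, w) \<in> D'" for w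
      using that D D' by blast
    ultimately have "D' `` {z} \<subseteq> ?V"
      using D' by auto
    then show ?thesis
      using D' by blast
  qed
  moreover have "openin X W \<longleftrightarrow> W \<subseteq> topspace X \<and> (\<forall>z\<in>W. \<exists>D\<in>\<U>. D `` {z} \<subseteq> W)" for W
    using conjunct2[OF assms(1)[unfolded compatible_uniformity_def]] by (rule spec)
  moreover have "?V \<subseteq> topspace X"
    by (rule Collect_restrict)
  ultimately show "openin X ?V"
    by simp
qed

lemma fragmented_map_continuous:
  assumes "continuous_map X X p"
  shows "fragmented_map X p"
  unfolding fragmented_map_def
proof (intro allI impI, elim conjE)
  fix A E assume A: "A \<subseteq> topspace X" "A \<noteq> {}" and "entourage X E"
  then obtain \<U> where U: "compatible_uniformity X \<U>" and "E \<in> \<U>"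
    by (auto simp: entourage_def)
  note U' = U[unfolded compatible_uniformity_def uniform_structure_on_def]
  obtain D where D: "D \<in> \<U>" "D O D \<subseteq> E"
    using U' \<open>E \<in> \<U>\<close> by meson
  then have "D \<inter> D\<inverse> \<in> \<U>"
    using U' by blast
  moreover obtain x where x: "x \<in> A"
    using A by blast
  moreover have "p x \<in> topspace X"
    using x A assms by (auto simp: continuous_map_def)
  ultimately obtain V where V: "openin X V" "p x \<in> V" "V \<subseteq> (D \<inter> D\<inverse>) `` {p x}"
    using compatible_uniformity_nhd[OF U] by metis
  let ?U = "{z \<in> topspace X. p z \<in> V}"
  have "openin X ?U"
    using assms V by (simp add: continuous_map_def)
  moreover have "?U \<inter> A \<noteq> {}"
    using x A V by blast
  moreover have "p ` (?U \<inter> A) \<times> p ` (?U \<inter> A) \<subseteq> E"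
    using V(3) D(2) by blast
  ultimately show "\<exists>U. openin X U \<and> U \<inter> A \<noteq> {} \<and> p ` (U \<inter> A) \<times> p ` (U \<inter> A) \<subseteq> E"
    by blast
qed

text \<open>
  A set other than \<open>{b}\<close> meets the open complement of \<open>b\<close>, where the map is constant, and \<open>{b}\<close>
  itself has a one-point image; so the value at \<open>b\<close> is immaterial.
\<close>

lemma fragmented_map_constant_off_point:
  assumes "t1_space X" and p: "p \<in> topspace X \<rightarrow> topspace X"
    and const: "\<And>x. x \<in> topspace X \<Longrightarrow> x \<noteq> b \<Longrightarrow> p x = a"
  shows "fragmented_map X p"
  unfolding fragmented_map_def
proof (intro allI impI, elim conjE)
  fix A E assume A: "A \<subseteq> topspace X" "A \<noteq> {}" and "entourage X E"
  then have refl: "(y, y) \<in> E" if "y \<in> topspace X" for y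
    using that
    unfolding entourage_def compatible_uniformity_def uniform_structure_on_def by blast
  show "\<exists>U. openin X U \<and> U \<inter> A \<noteq> {} \<and> p ` (U \<inter> A) \<times> p ` (U \<inter> A) \<subseteq> E"
  proof (cases "A = {b}")
    case True
    then have "p ` (topspace X \<inter> A) = {p b}" "p b \<in> topspace X"
      using A p by auto
    then show ?thesis
      using refl A by (intro exI[of _ "topspace X"]) auto
  next
    case False
    then obtain x where x: "x \<in> A" "x \<noteq> b"
      using A by blast
    have "openin X (topspace X - {b})"
      using assms(1) by (simp add: t1_space_openin_delete_alt)
    have "a \<in> topspace X"
      using const[of x] x A p by auto
    then have "(a, a) \<in> E"
      by (rule refl)
    have "p ` ((topspace X - {b}) \<inter> A) \<subseteq> {a}"
      using const by auto
    then have "p ` ((topspace X - {b}) \<inter> A) \<times> p ` ((topspace X - {b}) \<inter> A) \<subseteq> {a} \<times> {a}"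
      by (intro Sigma_mono)
    also have "\<dots> \<subseteq> E"
      using \<open>(a, a) \<in> E\<close> by simp
    finally have "p ` ((topspace X - {b}) \<inter> A) \<times> p ` ((topspace X - {b}) \<inter> A) \<subseteq> E" .
    moreover have "(topspace X - {b}) \<inter> A \<noteq> {}"
      using x A by auto
    moreover note \<open>openin X (topspace X - {b})\<close>
    ultimately show ?thesis
      by (intro exI[of _ "topspace X - {b}"]) simp
  qed
qed

section \<open>Maps preserving the cross-ratio\<close>

text \<open>
  Clearing denominators makes the condition closed under pointwise limits, at the price of
  admitting degenerate maps.
\<close>

definition moebius_identity :: "'a::field set \<Rightarrow> ('a \<Rightarrow> 'a) \<Rightarrow> bool" where
  "moebius_identity S p \<longleftrightarrow> (\<forall>a\<in>S. \<forall>b\<in>S. \<forall>c\<in>S. \<forall>d\<in>S.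
     (p a - p b) * (p c - p d) * ((a - c) * (b - d)) =
     (p a - p c) * (p b - p d) * ((a - b) * (c - d)))"

lemma moebius_identityD:
  assumes "moebius_identity S p" "a \<in> S" "b \<in> S" "c \<in> S" "d \<in> S"
  shows "(p a - p b) * (p c - p d) * ((a - c) * (b - d)) =
         (p a - p c) * (p b - p d) * ((a - b) * (c - d))"
  using assms unfolding moebius_identity_def by blast

text \<open>
  If \<open>p u = p v\<close> for some \<open>u \<noteq> v\<close>, the identity for \<open>u, v, c, d\<close> forces one of \<open>p c\<close>, \<open>p d\<close> to be
  this common value whenever \<open>c \<noteq> d\<close>.
\<close>

lemma moebius_identity_dichotomy:
  assumes p: "moebius_identity S p"
  shows "inj_on p S \<or> (\<exists>a b. \<forall>x\<in>S. x \<noteq> b \<longrightarrow> p x = a)"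
proof (cases "inj_on p S")
  case False
  then obtain u v where uv: "u \<in> S" "v \<in> S" "u \<noteq> v" "p u = p v"
    by (auto simp: inj_on_def)
  have *: "p c = p u \<or> p d = p u" if "c \<in> S" "d \<in> S" "c \<noteq> d" for c d
    using moebius_identityD[OF p uv(1,2) that(1,2)] that uv by auto
  show ?thesis
  proof (cases "\<exists>b\<in>S. p b \<noteq> p u")
    case True
    then obtain b where "b \<in> S" "p b \<noteq> p u"
      by blast
    then have "\<forall>x\<in>S. x \<noteq> b \<longrightarrow> p x = p u"
      using * by blast
    then show ?thesis
      by blast
  qed blast
qed blast

text \<open>
  Solving the identity for \<open>p x\<close>, with the other three arguments fixed, exhibits \<open>p\<close> as a
  fractional linear function; its denominator has no zero on \<open>S\<close> because \<open>p\<close> separates the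
  three fixed points.
\<close>

lemma moebius_identity_continuous_on:
  fixes S :: "'a::real_normed_field set"
  assumes p: "moebius_identity S p" "inj_on p S"
    and abc: "a \<in> S" "b \<in> S" "c \<in> S" "a \<noteq> b" "a \<noteq> c" "b \<noteq> c"
  shows "continuous_on S p"
proof -
  define K where "K = (p a - p b) * (a - c)"
  define L where "L = (p a - p c) * (a - b)"
  define N where "N x = L * p b * (c - x) - K * p c * (b - x)" for x
  define D where "D x = L * (c - x) - K * (b - x)" for x
  have KL: "K \<noteq> 0" "L \<noteq> 0"
    using abc p(2) by (auto simp: K_def L_def inj_on_def)
  have eq: "p x * D x = N x" if "x \<in> S" for x
    using moebius_identityD[OF p(1) abc(1-3) that]
    unfolding N_def D_def K_def L_def by algebra
  have "D x \<noteq> 0" if "x \<in> S" for x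
  proof
    assume D: "D x = 0"
    have pbc: "p b - p c \<noteq> 0"
      using abc p(2) by (auto simp: inj_on_def)
    have N: "N x = 0"
      using eq[OF that] D by simp
    have "L * (c - x) * (p b - p c) = N x - p c * D x"
         "K * (b - x) * (p b - p c) = N x - p b * D x"
      unfolding N_def D_def by (simp_all add: algebra_simps)
    then have "x = c" "x = b"
      using D N KL pbc by auto
    then show False
      using abc by simp
  qed
  moreover from this have "p x = N x / D x" if "x \<in> S" for x
    using eq[OF that] that by (simp add: eq_divide_eq)
  moreover have "continuous_on S N" "continuous_on S D"
    unfolding N_def D_def by (intro continuous_intros)+
  ultimately show ?thesis
    by (simp add: continuous_on_divide cong: continuous_on_cong)
qed

text \<open>
  The identities for \<open>f\<close> and \<open>g\<close> are chained by cancelling differences of values of \<open>g\<close>. As \<open>g\<close>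
  may be degenerate these can vanish, and then so do both sides for the composition.
\<close>

lemma moebius_identity_compose:
  assumes f: "moebius_identity S f" and g: "moebius_identity S g" "g \<in> S \<rightarrow> S"
  shows "moebius_identity S (compose S f g)"
  unfolding moebius_identity_def
proof (intro ballI)
  fix a b c d assume S: "a \<in> S" "b \<in> S" "c \<in> S" "d \<in> S"
  have gS: "g a \<in> S" "g b \<in> S" "g c \<in> S" "g d \<in> S"
    using S g by auto
  note F = moebius_identityD[OF f gS] and G = moebius_identityD[OF g(1) S]
  have "(f (g a) - f (g b)) * (f (g c) - f (g d)) * ((a - c) * (b - d)) =
        (f (g a) - f (g c)) * (f (g b) - f (g d)) * ((a - b) * (c - d))"
  proof (cases "(g a - g c) * (g b - g d) = 0 \<and> (g a - g b) * (g c - g d) = 0")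
    case False
    \<comment> \<open>Multiply the two identities and cancel the factor of \<open>g\<close> that does not vanish.\<close>
    let ?P = "(f (g a) - f (g b)) * (f (g c) - f (g d))"
    let ?Q = "(f (g a) - f (g c)) * (f (g b) - f (g d))"
    let ?m = "(g a - g c) * (g b - g d)" and ?n = "(g a - g b) * (g c - g d)"
    let ?r = "(a - c) * (b - d)" and ?s = "(a - b) * (c - d)"
    have "?m * (?P * ?r) = ?m * (?Q * ?s)" "?n * (?P * ?r) = ?n * (?Q * ?s)"
      using F G by algebra+
    then show ?thesis
      using False by auto
  next
    case True
    then consider "g a = g c" "g a = g b" | "g a = g c" "g c = g d"
      | "g b = g d" "g a = g b" | "g b = g d" "g c = g d"
      by auto
    then show ?thesis
      by cases auto
  qed
  then show "(compose S f g a - compose S f g b) * (compose S f g c - compose S f g d) *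
        ((a - c) * (b - d)) =
        (compose S f g a - compose S f g c) * (compose S f g b - compose S f g d) *
        ((a - b) * (c - d))"
    using S by (simp add: compose_eq)
qed

definition moebius_bij :: "'a::field set \<Rightarrow> ('a \<Rightarrow> 'a) set" where
  "moebius_bij S = {g \<in> Bij S. moebius_identity S g}"

definition moebius_group :: "'a::field set \<Rightarrow> ('a \<Rightarrow> 'a) monoid" where
  "moebius_group S = BijGroup S\<lparr>carrier := moebius_bij S\<rparr>"

lemma carrier_moebius_group [simp]: "carrier (moebius_group S) = moebius_bij S"
  by (simp add: moebius_group_def)

lemma moebius_bij_inv:
  assumes "g \<in> moebius_bij S"
  shows "restrict (inv_into S g) S \<in> moebius_bij S"
proof -
  have g: "g \<in> Bij S" "moebius_identity S g" and im: "g ` S = S"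
    using assms by (auto simp: moebius_bij_def Bij_def bij_betw_def)
  have inv: "inv_into S g x \<in> S" "g (inv_into S g x) = x" if "x \<in> S" for x
    using that im by (auto simp: inv_into_into f_inv_into_f)
  have "moebius_identity S (restrict (inv_into S g) S)"
    unfolding moebius_identity_def
  proof (intro ballI)
    fix a b c d assume S: "a \<in> S" "b \<in> S" "c \<in> S" "d \<in> S"
    let ?h = "restrict (inv_into S g) S"
    show "(?h a - ?h b) * (?h c - ?h d) * ((a - c) * (b - d)) =
          (?h a - ?h c) * (?h b - ?h d) * ((a - b) * (c - d))"
      using moebius_identityD[OF g(2) inv(1)[OF S(1)] inv(1)[OF S(2)] inv(1)[OF S(3)] inv(1)[OF S(4)]]
      by (simp add: S inv(2) mult.commute)
  qed
  then show ?thesis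
    using g restrict_inv_into_Bij by (simp add: moebius_bij_def)
qed

lemma subgroup_moebius_bij: "subgroup (moebius_bij S) (BijGroup S)"
proof (rule group.subgroupI[OF group_BijGroup])
  show "moebius_bij S \<subseteq> carrier (BijGroup S)"
    by (auto simp: moebius_bij_def BijGroup_def)
  have "(\<lambda>x\<in>S. x) \<in> moebius_bij S"
    using id_Bij[of S] by (auto simp: moebius_bij_def moebius_identity_def)
  then show "moebius_bij S \<noteq> {}"
    by blast
next
  fix g assume "g \<in> moebius_bij S"
  then show "inv\<^bsub>BijGroup S\<^esub> g \<in> moebius_bij S"
    using moebius_bij_inv[of g S] by (simp add: inv_BijGroup moebius_bij_def)
next
  fix f g assume "f \<in> moebius_bij S" "g \<in> moebius_bij S"
  then show "f \<otimes>\<^bsub>BijGroup S\<^esub> g \<in> moebius_bij S"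
    by (auto simp: moebius_bij_def BijGroup_def compose_Bij
        intro!: moebius_identity_compose dest: Bij_imp_funcset)
qed

lemma group_moebius_group: "group (moebius_group S)"
  unfolding moebius_group_def
  by (rule group.subgroup_imp_group[OF group_BijGroup subgroup_moebius_bij])

lemma group_action_moebius: "group_action (moebius_group S) S id"
  unfolding group_action_def moebius_group_def
  by (rule group.canonical_inj_is_hom[OF group_BijGroup subgroup_moebius_bij])

lemma moebius_group_homeomorphic_map:
  fixes S :: "'a::real_normed_field set"
  assumes abc: "a \<in> S" "b \<in> S" "c \<in> S" "a \<noteq> b" "a \<noteq> c" "b \<noteq> c"
    and g: "g \<in> moebius_bij S"
  shows "homeomorphic_map (top_of_set S) (top_of_set S) g"
proof -
  have cont: "continuous_map (top_of_set S) (top_of_set S) f" if f: "f \<in> moebius_bij S" for f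
  proof -
    have "f \<in> Bij S" "moebius_identity S f" "inj_on f S"
      using f by (auto simp: moebius_bij_def Bij_def bij_betw_def)
    then show ?thesis
      using moebius_identity_continuous_on[OF _ _ abc] Bij_imp_funcset[of f S] by auto
  qed
  have "g ` S = S" "inj_on g S"
    using g by (auto simp: moebius_bij_def Bij_def bij_betw_def)
  then have "homeomorphic_maps (top_of_set S) (top_of_set S) g (restrict (inv_into S g) S)"
    unfolding homeomorphic_maps_def
    using cont[OF g] cont[OF moebius_bij_inv[OF g]] by (auto simp: f_inv_into_f)
  then show ?thesis
    using homeomorphic_map_maps by blast
qed

lemma closedin_moebius_identity:
  fixes S :: "'a::real_normed_field set"
  defines "Y \<equiv> product_topology (\<lambda>_. top_of_set S) S"
  shows "closedin Y {p \<in> topspace Y. moebius_identity S p}"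
proof -
  define C where "C = (\<lambda>(a, b, c, d). {p \<in> topspace Y.
     (p a - p b) * (p c - p d) * ((a - c) * (b - d)) =
     (p a - p c) * (p b - p d) * ((a - b) * (c - d))})"
  have ev: "continuous_map Y euclidean (\<lambda>p. p x)" if "x \<in> S" for x
    using continuous_map_product_projection[OF that, of "\<lambda>_. top_of_set S"]
    unfolding Y_def by (rule continuous_map_into_fulltopology)
  have mult: "continuous_map Y euclidean (\<lambda>p. f p * g p)"
    if "continuous_map Y euclidean f" "continuous_map Y euclidean g"
    for f g :: "('a \<Rightarrow> 'a) \<Rightarrow> 'a"
    using that by (simp add: continuous_map_atin tendsto_mult)
  have diff: "continuous_map Y euclidean (\<lambda>p. f p - g p)"
    if "continuous_map Y euclidean f" "continuous_map Y euclidean g"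
    for f g :: "('a \<Rightarrow> 'a) \<Rightarrow> 'a"
    using that by (simp add: continuous_map_atin tendsto_diff)
  have closed: "closedin Y (C t)" if "t \<in> S \<times> S \<times> S \<times> S" for t
    using that unfolding C_def
    by (auto intro!: closedin_continuous_maps_eq[where Y = euclidean] mult diff ev)
  show ?thesis
  proof (cases "S = {}")
    case True
    then have "{p \<in> topspace Y. moebius_identity S p} = topspace Y"
      by (auto simp: moebius_identity_def)
    then show ?thesis
      by simp
  next
    case False
    then have "{p \<in> topspace Y. moebius_identity S p} = (\<Inter>t\<in>S \<times> S \<times> S \<times> S. C t)"
      unfolding C_def moebius_identity_def by auto
    then show ?thesis
      using False closed by (auto intro!: closedin_INT)
  qed
qed

lemma tame_system_moebius:
  fixes S :: "'a::real_normed_field set"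
  assumes abc: "a \<in> S" "b \<in> S" "c \<in> S" "a \<noteq> b" "a \<noteq> c" "b \<noteq> c"
  shows "tame_system (moebius_group S) (top_of_set S) id"
  unfolding tame_system_def
proof
  let ?X = "top_of_set S"
  let ?Y = "product_topology (\<lambda>_. ?X) S"
  fix p assume "p \<in> enveloping_semigroup (moebius_group S) ?X id"
  moreover have "moebius_bij S \<subseteq> {p \<in> topspace ?Y. moebius_identity S p}"
    by (auto simp: moebius_bij_def PiE_def Bij_imp_extensional dest: Bij_imp_funcset)
  then have "?Y closure_of moebius_bij S \<subseteq> {p \<in> topspace ?Y. moebius_identity S p}"
    using closedin_moebius_identity by (rule closure_of_minimal)
  ultimately have "p \<in> {p \<in> topspace ?Y. moebius_identity S p}"
    by (auto simp: enveloping_semigroup_def)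
  then have p: "p \<in> S \<rightarrow> S" "moebius_identity S p"
    by (auto simp: PiE_def)
  have "t1_space ?X"
    by (simp add: Hausdorff_imp_t1_space Hausdorff_space_subtopology)
  then show "fragmented_map ?X p"
    using moebius_identity_dichotomy[OF p(2)]
  proof (elim disjE exE)
    assume "inj_on p S"
    then have "continuous_map ?X ?X p"
      using moebius_identity_continuous_on[OF p(2) _ abc] p(1) by auto
    then show ?thesis
      by (rule fragmented_map_continuous)
  next
    fix a b assume "\<forall>x\<in>S. x \<noteq> b \<longrightarrow> p x = a"
    then show ?thesis
      using p(1) \<open>t1_space ?X\<close> by (auto intro!: fragmented_map_constant_off_point[of _ _ b a])
  qed
qed

section \<open>Fixed points and invariant measures\<close>

lemma sets_borel_algebra_openin:
  assumes "openin X U"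
  shows "U \<in> sets (borel_algebra X)"
  using assms unfolding borel_algebra_def
  by (subst sets_measure_of) (auto dest: openin_subset)

lemma space_borel_algebra [simp]: "space (borel_algebra X) = topspace X"
  unfolding borel_algebra_def by (subst space_measure_of) (auto dest: openin_subset)

lemma measurable_borel_algebra:
  assumes "continuous_map X Y f"
  shows "f \<in> measurable (borel_algebra X) (borel_algebra Y)"
  unfolding borel_algebra_def[of Y]
proof (rule measurable_measure_of)
  show "{U. openin Y U} \<subseteq> Pow (topspace Y)"
    by (auto dest: openin_subset)
  show "f \<in> space (borel_algebra X) \<rightarrow> topspace Y"
    using assms by (auto simp: continuous_map_def)
  fix U assume "U \<in> {U. openin Y U}"
  then have "openin X {x \<in> topspace X. f x \<in> U}"
    using assms by (simp add: continuous_map_def)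
  moreover have "f -` U \<inter> space (borel_algebra X) = {x \<in> topspace X. f x \<in> U}"
    by auto
  ultimately show "f -` U \<inter> space (borel_algebra X) \<in> sets (borel_algebra X)"
    using sets_borel_algebra_openin by metis
qed

lemma homeomorphic_map_image_sets_borel:
  assumes f: "homeomorphic_map X Y f" and A: "A \<in> sets (borel_algebra X)"
  shows "f ` A \<in> sets (borel_algebra Y)"
proof -
  obtain g where g: "homeomorphic_maps X Y f g"
    using f homeomorphic_map_maps by blast
  have "A \<subseteq> topspace X"
    using sets.sets_into_space[OF A] by simp
  then have "g -` A \<inter> topspace Y = f ` A"
    using g by (auto simp: homeomorphic_maps_def continuous_map_def Pi_iff subset_iff image_iff)
      metis
  moreover have "g \<in> measurable (borel_algebra Y) (borel_algebra X)"
    using g by (intro measurable_borel_algebra) (simp add: homeomorphic_maps_def)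
  then have "g -` A \<inter> space (borel_algebra Y) \<in> sets (borel_algebra Y)"
    using A by (rule measurable_sets)
  ultimately show ?thesis
    by simp
qed

text \<open>
  Invariance is phrased with images and the action on measures with preimages, so the measure of
  \<open>\<phi> g ` A\<close> is computed by pushing forward along the inverse of \<open>g\<close>.
\<close>

lemma fixed_point_imp_invariant_measure:
  fixes G (structure)
  assumes sys: "compact_G_system G X \<phi>"
    and fp: "has_fixed_point G (prob_measures_topology X) (prob_measures_action X \<phi>)"
  obtains \<mu> where "regular_borel_probability X \<mu>" "invariant_measure G \<phi> \<mu>"
proof -
  obtain \<mu> where reg: "regular_borel_probability X \<mu>"
    and fixed: "\<And>g. g \<in> carrier G \<Longrightarrow> distr \<mu> (borel_algebra X) (\<phi> g) = \<mu>"
    using fp by (auto simp: has_fixed_point_def prob_measures_action_def)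
  interpret group_action G "topspace X" \<phi>
    using sys by (simp add: compact_G_system_def)
  interpret group G
    using group_hom group_hom.axioms(1) by blast
  have sets: "sets \<mu> = sets (borel_algebra X)"
    using reg by (simp add: regular_borel_probability_def)
  then have space: "space \<mu> = topspace X"
    using sets_eq_imp_space_eq[of \<mu> "borel_algebra X"] by simp
  have "emeasure \<mu> (\<phi> g ` A) = emeasure \<mu> A" if g: "g \<in> carrier G" and A: "A \<in> sets \<mu>" for g A
  proof -
    have "A \<subseteq> topspace X"
      using A sets.sets_into_space space by blast
    have g': "inv g \<in> carrier G"
      using g by simp
    have "continuous_map X X (\<phi> (inv g))"
      using sys g' by (simp add: compact_G_system_def homeomorphic_imp_continuous_map)
    then have "\<phi> (inv g) \<in> measurable \<mu> (borel_algebra X)"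
      using measurable_borel_algebra sets measurable_cong_sets by blast
    then have "emeasure \<mu> A = emeasure \<mu> (\<phi> (inv g) -` A \<inter> space \<mu>)"
      using emeasure_distr[of "\<phi> (inv g)" \<mu> "borel_algebra X" A] fixed[OF g'] A sets by simp
    also have "\<phi> (inv g) -` A \<inter> space \<mu> = \<phi> g ` A"
    proof (intro equalityI subsetI)
      fix x assume "x \<in> \<phi> (inv g) -` A \<inter> space \<mu>"
      then have "\<phi> (inv g) x \<in> A" "x \<in> topspace X"
        using space by auto
      moreover from this have "\<phi> (inv (inv g)) (\<phi> (inv g) x) = x"
        using orbit_sym_aux[OF g'] by blast
      ultimately show "x \<in> \<phi> g ` A"
        using g by (metis image_eqI inv_inv)
    next
      fix x assume "x \<in> \<phi> g ` A"
      then obtain y where "y \<in> A" "x = \<phi> g y"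
        by blast
      moreover from this have "\<phi> (inv g) x = y" "x \<in> topspace X"
        using orbit_sym_aux[OF g] element_image[OF g] \<open>A \<subseteq> topspace X\<close> by blast+
      ultimately show "x \<in> \<phi> (inv g) -` A \<inter> space \<mu>"
        using space by simp
    qed
    finally show ?thesis
      by simp
  qed
  then show ?thesis
    using that reg by (simp add: invariant_measure_def)
qed

section \<open>The circle\<close>

lemma rotation_moebius:
  fixes u :: "'a::real_normed_field"
  assumes "norm u = 1"
  shows "(\<lambda>z\<in>sphere 0 1. u * z) \<in> moebius_bij (sphere 0 1)"
proof -
  have "u \<noteq> 0"
    using assms by auto
  then have "bij_betw (\<lambda>z. u * z) (sphere 0 1) (sphere 0 1)"
    using assms by (intro bij_betw_byWitness[where f' = "\<lambda>z. z / u"])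
      (auto simp: norm_mult norm_divide)
  then have "(\<lambda>z\<in>sphere 0 1. u * z) \<in> Bij (sphere 0 1)"
    by (simp add: Bij_def)
  moreover have "moebius_identity (sphere 0 1) (\<lambda>z\<in>sphere 0 1. u * z)"
    unfolding moebius_identity_def
    by (auto simp flip: right_diff_distrib)
  ultimately show ?thesis
    by (simp add: moebius_bij_def)
qed

lemma minimal_system_circle:
  "minimal_system (moebius_group (sphere 0 1)) (top_of_set (sphere (0::complex) 1)) id"
  unfolding minimal_system_def
proof (intro conjI notI)
  let ?S = "sphere (0::complex) 1"
  have "1 \<in> ?S"
    by simp
  then show "False" if "topspace (top_of_set ?S) = {}"
    using that by auto
  assume "\<exists>C. closedin (top_of_set ?S) C \<and> C \<noteq> {} \<and> C \<noteq> topspace (top_of_set ?S) \<and>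
            (\<forall>g\<in>carrier (moebius_group ?S). id g ` C \<subseteq> C)"
  then obtain C where closed: "closedin (top_of_set ?S) C" and C: "C \<noteq> {}" "C \<noteq> ?S"
    and inv: "\<And>g. g \<in> moebius_bij ?S \<Longrightarrow> g ` C \<subseteq> C"
    by (elim exE conjE) simp
  have "C \<subseteq> ?S"
    using closedin_subset[OF closed] by simp
  obtain z where z: "z \<in> C"
    using C by blast
  then have nz: "norm z = 1"
    using \<open>C \<subseteq> ?S\<close> by auto
  have "w \<in> C" if "w \<in> ?S" for w
  proof -
    have "norm (w / z) = 1"
      using that nz by (simp add: norm_divide)
    then have "(\<lambda>x\<in>?S. w / z * x) z \<in> C"
      using inv[OF rotation_moebius] z by blast
    moreover have "z \<noteq> 0"
      using nz by auto
    ultimately show ?thesis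
      using nz by simp
  qed
  then show False
    using C \<open>C \<subseteq> ?S\<close> by blast
qed

definition hyperbolic :: "complex \<Rightarrow> complex" where
  "hyperbolic = (\<lambda>z\<in>sphere 0 1. (2 * z + 1) / (z + 2))"

lemma norm_one_denominators_nonzero:
  assumes "norm (z::complex) = 1"
  shows "z + 2 \<noteq> 0" "2 - z \<noteq> 0"
proof -
  show "z + 2 \<noteq> 0"
  proof
    assume "z + 2 = 0"
    then have "z = - 2"
      by (rule add.inverse_unique[THEN sym, OF trans[OF add.commute]])
    then show False
      using assms by simp
  qed
  show "2 - z \<noteq> 0"
    using assms by auto
qed

lemma norm_one_iff: "norm z = 1 \<longleftrightarrow> (Re z)\<^sup>2 + (Im z)\<^sup>2 = 1"
  by (simp add: cmod_def)

lemma hyperbolic_moebius: "hyperbolic \<in> moebius_bij (sphere 0 1)"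
proof -
  let ?S = "sphere (0::complex) 1"
  have n1: "norm ((2 * z + 1) / (z + 2)) = 1" if z: "norm z = 1" for z :: complex
  proof -
    have "(norm (2 * z + 1))\<^sup>2 = (norm (z + 2))\<^sup>2"
      using z unfolding norm_one_iff cmod_power2 by (simp add: power2_eq_square algebra_simps)
    then have "norm (2 * z + 1) = norm (z + 2)"
      by (simp add: power2_eq_iff_nonneg)
    then show ?thesis
      using norm_one_denominators_nonzero(1)[OF z] by (simp add: norm_divide)
  qed
  have n2: "norm ((2 * z - 1) / (2 - z)) = 1" if z: "norm z = 1" for z :: complex
  proof -
    have "(norm (2 * z - 1))\<^sup>2 = (norm (2 - z))\<^sup>2"
      using z unfolding norm_one_iff cmod_power2 by (simp add: power2_eq_square algebra_simps)
    then have "norm (2 * z - 1) = norm (2 - z)"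
      by (simp add: power2_eq_iff_nonneg)
    then show ?thesis
      using norm_one_denominators_nonzero(2)[OF z] by (simp add: norm_divide)
  qed
  have i1: "(2 * ((2 * z + 1) / (z + 2)) - 1) / (2 - (2 * z + 1) / (z + 2)) = z"
    if "norm z = 1" for z :: complex
  proof -
    have "2 * ((2 * z + 1) / (z + 2)) - 1 = 3 * z / (z + 2)"
         "2 - (2 * z + 1) / (z + 2) = 3 / (z + 2)"
      using norm_one_denominators_nonzero(1)[OF that] by (simp_all add: field_simps)
    then show ?thesis
      using norm_one_denominators_nonzero(1)[OF that] by simp
  qed
  have i2: "(2 * ((2 * z - 1) / (2 - z)) + 1) / ((2 * z - 1) / (2 - z) + 2) = z"
    if "norm z = 1" for z :: complex
  proof -
    have "2 * ((2 * z - 1) / (2 - z)) + 1 = 3 * z / (2 - z)"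
         "(2 * z - 1) / (2 - z) + 2 = 3 / (2 - z)"
      using norm_one_denominators_nonzero(2)[OF that] by (simp_all add: field_simps)
    then show ?thesis
      using norm_one_denominators_nonzero(2)[OF that] by simp
  qed
  have "bij_betw (\<lambda>z. (2 * z + 1) / (z + 2)) ?S ?S"
    using n1 n2 i1 i2
    by (intro bij_betw_byWitness[where f' = "\<lambda>z. (2 * z - 1) / (2 - z)"]) auto
  then have "hyperbolic \<in> Bij ?S"
    by (simp add: Bij_def hyperbolic_def)
  moreover have "moebius_identity ?S hyperbolic"
    unfolding moebius_identity_def
  proof (intro ballI)
    fix a b c d assume S: "a \<in> ?S" "b \<in> ?S" "c \<in> ?S" "d \<in> ?S"
    define k where "k x = inverse (x + 2)" for x :: complex
    have *: "hyperbolic x - hyperbolic y = 3 * (x - y) * (k x * k y)"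
      if "x \<in> ?S" "y \<in> ?S" for x y
    proof -
      have "x + 2 \<noteq> 0" "y + 2 \<noteq> 0"
        using norm_one_denominators_nonzero(1) that by auto
      then show ?thesis
        using that by (simp add: hyperbolic_def k_def diff_frac_eq divide_simps) (simp add: algebra_simps)
    qed
    show "(hyperbolic a - hyperbolic b) * (hyperbolic c - hyperbolic d) * ((a - c) * (b - d)) =
          (hyperbolic a - hyperbolic c) * (hyperbolic b - hyperbolic d) * ((a - b) * (c - d))"
      unfolding *[OF S(1,2)] *[OF S(3,4)] *[OF S(1,3)] *[OF S(2,4)]
      by algebra
  qed
  ultimately show ?thesis
    by (simp add: moebius_bij_def)
qed

text \<open>
  On the circle, the real part of \<open>hyperbolic z\<close> is \<open>(4 + 5 * Re z) / (norm (z + 2))\<^sup>2\<close>.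
\<close>

lemma Re_hyperbolic_pos_iff:
  assumes "norm z = 1"
  shows "Re (hyperbolic z) > 0 \<longleftrightarrow> Re z > - 4/5"
proof -
  have "z + 2 \<noteq> 0"
    using assms by (rule norm_one_denominators_nonzero)
  then have pos: "(Re (z + 2))\<^sup>2 + (Im (z + 2))\<^sup>2 > 0"
    by (simp add: complex_eq_iff sum_power2_gt_zero_iff)
  have "Re (hyperbolic z) = Re ((2 * z + 1) / (z + 2))"
    using assms by (simp add: hyperbolic_def)
  also have "\<dots> = (Re (2 * z + 1) * Re (z + 2) + Im (2 * z + 1) * Im (z + 2)) /
      ((Re (z + 2))\<^sup>2 + (Im (z + 2))\<^sup>2)"
    by (rule Re_divide)
  also have "Re (2 * z + 1) * Re (z + 2) + Im (2 * z + 1) * Im (z + 2) = 4 + 5 * Re z"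
    using assms unfolding norm_one_iff by (simp add: power2_eq_square algebra_simps)
  finally show ?thesis
    using pos by (auto simp: zero_less_divide_iff)
qed

lemma hyperbolic_image_arc:
  "hyperbolic ` {z \<in> sphere 0 1. Re z > - 4/5} = {z \<in> sphere 0 1. Re z > 0}"
proof -
  have im: "hyperbolic ` sphere 0 1 = sphere 0 1"
    using hyperbolic_moebius by (simp add: moebius_bij_def Bij_def bij_betw_def)
  show ?thesis
  proof (intro equalityI subsetI)
    fix w assume "w \<in> hyperbolic ` {z \<in> sphere 0 1. Re z > - 4/5}"
    then show "w \<in> {z \<in> sphere 0 1. Re z > 0}"
      using im Re_hyperbolic_pos_iff by auto
  next
    fix w :: complex assume w: "w \<in> {z \<in> sphere 0 1. Re z > 0}"
    then obtain z where "z \<in> sphere 0 1" "w = hyperbolic z"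
      using im by blast
    then show "w \<in> hyperbolic ` {z \<in> sphere 0 1. Re z > - 4/5}"
      using w Re_hyperbolic_pos_iff[of z] by auto
  qed
qed

text \<open>
  Since \<open>2 * (4/5)\<^sup>2 > 1\<close>, one of \<open>Re w\<close>, \<open>Im w\<close> is smaller than \<open>4/5\<close> in absolute value; the
  quarter turns move that coordinate, with either sign, to the real part.
\<close>

lemma circle_covered_by_rotations:
  "sphere (0::complex) 1 \<subseteq>
     (\<Union>u\<in>{1, -1, \<i>, -\<i>}. (\<lambda>z\<in>sphere 0 1. u * z) `
       {z \<in> sphere 0 1. - 4/5 < Re z \<and> Re z \<le> 0})" (is "_ \<subseteq> (\<Union>u\<in>_. ?r u ` ?N)")
proof
  fix w :: complex assume w: "w \<in> sphere 0 1"
  have *: "w \<in> ?r u ` ?N"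
    if u: "u * v = 1" "norm v = 1" and "- 4/5 < Re (v * w)" "Re (v * w) \<le> 0" for u v
  proof (rule image_eqI)
    show "v * w \<in> ?N"
      using that w by (simp add: norm_mult)
    then show "w = ?r u (v * w)"
      using u by (simp flip: mult.assoc)
  qed
  have sq: "(Re w)\<^sup>2 + (Im w)\<^sup>2 = 1"
    using w norm_one_iff by simp
  have "\<bar>Re w\<bar> < 4/5 \<or> \<bar>Im w\<bar> < 4/5"
  proof (rule ccontr)
    assume "\<not> ?thesis"
    then have "4/5 \<le> \<bar>Re w\<bar>" "4/5 \<le> \<bar>Im w\<bar>"
      by linarith+
    then have "(4/5)\<^sup>2 \<le> \<bar>Re w\<bar>\<^sup>2" "(4/5)\<^sup>2 \<le> \<bar>Im w\<bar>\<^sup>2"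
      by (intro power_mono; simp)+
    then show False
      using sq by (simp add: power2_eq_square)
  qed
  then consider "- 4/5 < Re w" "Re w \<le> 0" | "- 4/5 < - Re w" "- Re w \<le> 0"
    | "- 4/5 < Im w" "Im w \<le> 0" | "- 4/5 < - Im w" "- Im w \<le> 0"
    by linarith
  then show "w \<in> (\<Union>u\<in>{1, -1, \<i>, -\<i>}. ?r u ` ?N)"
  proof cases
    case 1
    then show ?thesis
      using *[of 1 1] by simp
  next
    case 2
    then show ?thesis
      using *[of "-1" "-1"] by simp
  next
    case 3
    then show ?thesis
      using *[of "\<i>" "-\<i>"] by simp
  next
    case 4
    then show ?thesis
      using *[of "-\<i>" "\<i>"] by simp
  qed
qed

lemma compact_G_system_circle:
  "compact_G_system (moebius_group (sphere 0 1)) (top_of_set (sphere (0::complex) 1)) id"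
  unfolding compact_G_system_def
  using moebius_group_homeomorphic_map[of 1 "sphere (0::complex) 1" "-1" \<i>] group_action_moebius
  by (auto simp: compact_space_subtopology Hausdorff_space_subtopology complex_eq_iff)

lemma no_invariant_measure_circle:
  assumes reg: "regular_borel_probability (top_of_set (sphere (0::complex) 1)) \<mu>"
  shows "\<not> invariant_measure (moebius_group (sphere 0 1)) id \<mu>"
proof
  let ?S = "sphere (0::complex) 1"
  let ?N = "{z \<in> ?S. - 4/5 < Re z \<and> Re z \<le> 0}"
  let ?r = "\<lambda>u. \<lambda>z\<in>?S. u * z"
  assume "invariant_measure (moebius_group ?S) id \<mu>"
  then have inv: "emeasure \<mu> (g ` A) = emeasure \<mu> A" if "g \<in> moebius_bij ?S" "A \<in> sets \<mu>" for g A
    using that by (simp add: invariant_measure_def)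
  interpret prob_space \<mu>
    using reg by (simp add: regular_borel_probability_def)
  have sets: "sets \<mu> = sets (borel_algebra (top_of_set ?S))"
    using reg by (simp add: regular_borel_probability_def)
  then have space: "space \<mu> = ?S"
    using sets_eq_imp_space_eq[of \<mu> "borel_algebra (top_of_set ?S)"] by simp
  have arc: "{z \<in> ?S. Re z > c} \<in> sets \<mu>" for c
  proof -
    have "openin (top_of_set ?S) (?S \<inter> {z. Re z > c})"
      by (intro openin_open_Int open_halfspace_Re_gt)
    moreover have "?S \<inter> {z. Re z > c} = {z \<in> ?S. Re z > c}"
      by blast
    ultimately show ?thesis
      using sets sets_borel_algebra_openin by metis
  qed
  have N: "?N = {z \<in> ?S. Re z > - 4/5} - {z \<in> ?S. Re z > 0}"
    by auto
  have N_sets: "?N \<in> sets \<mu>"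
    unfolding N by (intro sets.Diff arc)
  have "emeasure \<mu> {z \<in> ?S. Re z > 0} = emeasure \<mu> {z \<in> ?S. Re z > - 4/5}"
    using inv[OF hyperbolic_moebius arc[of "- 4/5"]] hyperbolic_image_arc by simp
  then have N0: "emeasure \<mu> ?N = 0"
    unfolding N by (subst emeasure_Diff[OF _ arc arc]) auto
  have null: "?r u ` ?N \<in> null_sets \<mu>" if u: "norm u = 1" for u
  proof -
    have "homeomorphic_map (top_of_set ?S) (top_of_set ?S) (?r u)"
      using compact_G_system_circle rotation_moebius[OF u] by (simp add: compact_G_system_def)
    then have "?r u ` ?N \<in> sets \<mu>"
      using N_sets unfolding sets by (rule homeomorphic_map_image_sets_borel)
    then show ?thesis
      using inv[OF rotation_moebius[OF u] N_sets] N0 by (simp add: null_sets_def)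
  qed
  have "(\<Union>u\<in>{1, -1, \<i>, -\<i>}. ?r u ` ?N) \<in> null_sets \<mu>"
  proof (rule null_sets_UN')
    fix u :: complex assume "u \<in> {1, -1, \<i>, -\<i>}"
    then show "?r u ` ?N \<in> null_sets \<mu>"
      by (intro null) auto
  qed simp
  moreover have "space \<mu> \<subseteq> (\<Union>u\<in>{1, -1, \<i>, -\<i>}. ?r u ` ?N)"
    unfolding space by (rule circle_covered_by_rotations)
  ultimately have "space \<mu> \<in> null_sets \<mu>"
    using null_sets_subset sets.top by blast
  then show False
    using emeasure_space_1 by (simp add: null_sets_def)
qed

theorem mainTheorem7:
  shows "\<exists>(G :: (complex \<Rightarrow> complex) monoid) (X :: complex topology)
            (\<phi> :: (complex \<Rightarrow> complex) \<Rightarrow> complex \<Rightarrow> complex).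
           group G \<and>
           compact_G_system G X \<phi> \<and>
           metrizable_space X \<and>
           minimal_system G X \<phi> \<and>
           tame_system G X \<phi> \<and>
           \<not> has_fixed_point G (prob_measures_topology X) (prob_measures_action X \<phi>) \<and>
           \<not> (\<exists>\<mu>. regular_borel_probability X \<mu> \<and> invariant_measure G \<phi> \<mu>)"
proof (intro exI conjI)
  let ?S = "sphere (0::complex) 1"
  let ?G = "moebius_group ?S" and ?X = "top_of_set ?S"
  show "group ?G"
    by (rule group_moebius_group)
  show "compact_G_system ?G ?X id"
    by (rule compact_G_system_circle)
  show "metrizable_space ?X"
    by (simp add: metrizable_space_euclidean metrizable_space_subtopology)
  show "minimal_system ?G ?X id"
    by (rule minimal_system_circle)
  show "tame_system ?G ?X id"
    by (rule tame_system_moebius[of 1 _ "-1" \<i>]) (auto simp: complex_eq_iff)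
  show "\<not> (\<exists>\<mu>. regular_borel_probability ?X \<mu> \<and> invariant_measure ?G id \<mu>)"
    using no_invariant_measure_circle by blast
  then show "\<not> has_fixed_point ?G (prob_measures_topology ?X) (prob_measures_action ?X id)"
    using fixed_point_imp_invariant_measure[OF compact_G_system_circle] by metis
qed

end
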